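(* Let $N\in\mathbb N$, $N\ge 1$, be the number of noise samples, let $\beta\in(0,1)$ be a confidence parameter, and let $w^{(1)},\dots,w^{(N)}$ be i.i.d. samples of the process noise, drawn according to the (unknown) probability measure $\mathbb P$ on $\Delta\subset\mathbb R^n$. Assume the non-accumulation condition stated in the context. Let $s,s'\in S$ and $a\in Act(s)$, let $P(s,a)(s')$ be the transition probability defined in the context, and let $$N_{s'}^{\mathrm{out}}=\big|\{i\in\{1,\dots,N\} : d_a+w^{(i)}\notin R_{s'}\}\big|.$$ Then $$\mathbb P^N\big\{\underline p\le P(s,a)(s')\le \bar p\big\}\ge 1-\beta,$$ where $\underline p=0$ if $N_{s'}^{\mathrm{out}}=N$, and otherwise $\underline p\in[0,1]$ is the solution of $$\frac{\beta}{2N}=\sum_{i=0}^{N_{s'}^{\mathrm{out}}}\binom Ni(1-\underline p)^i\,\underline p^{\,N-i},$$ and $\bar p=1$ if $N_{s'}^{\mathrm{out}}=0$, and otherwise $\bar p\in[0,1]$ is the solution of $$\frac{\beta}{2N}=1-\sum_{i=0}^{N_{s'}^{\mathrm{out}}-1}\binom Ni(1-\bar p)^i\,\bar p^{\,N-i}.$$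
   Context: System: $x_{k+1}=Ax_k+Bu_k+q_k+w_k$ with $x_k\in\mathbb R^n$, $u_k\in\mathcal U\subset\mathbb R^p$, $A\in\mathbb R^{n\times n}$, $B\in\mathbb R^{n\times p}$ of full row rank, known $q_k\in\mathbb R^n$, and process noise $w_k$, i.i.d. in time, a random variable on $(\Delta,\mathcal D,\mathbb P)$ with $\Delta\subset\mathbb R^n$. $\mathbb P^N$ is the product measure on $\Delta^N$. Partition: a bounded set $\mathcal X\subset\mathbb R^n$ is partitioned into finitely many disjoint regions $R_1,\dots,R_v$, where each $R_i$ is a bounded, full-dimensional convex polytope $\{x: M_ix\le b_i\}$ (boundary points shared by several polytopes being allotted to exactly one region). In addition there is one absorbing region $R_\ast=\mathbb R^n\setminus\mathcal X$. The finite state set is $S=\{s_1,\dots,s_v,s_\ast\}$, and $R_s$ denotes the region of $s\in S$. Actions: $Act$ is a finite set; each $a\in Act$ has a fixed target point $d_a\in\mathbb R^n$. Action $a$ is enabled in $s$, written $a\in Act(s)$, if and only if for every $x\in R_s$ (and every time $k$) there is $u\in\mathcal U$ with $d_a=Ax+Bu+q_k$. Taking $a$ in a state $x_k\in R_s$ means applying $u_k(x_k,a)=B^+(d_a-q_k-Ax_k)$, with $B^+$ the pseudoinverse, so the successor is $x_{k+1}=d_a+w_k$. Transition probability: $P(s,a)(s')$ is the probability that $x_{k+1}\in R_{s'}$ when $a\in Act(s)$ is taken in any $x_k\in R_s$, i.e. $P(s,a)(s')=\mathbb P\{w\in\Delta: d_a+w\in R_{s'}\}$. Non-accumulation condition: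 for each polytopic region $R_{s'}$ fix a Chebyshev center $h_{s'}$ (center of a largest ball inscribed in the polytope), and for $\lambda\ge 0$ let $R_{s'}(\lambda)=\{h_{s'}+\lambda(x-h_{s'}): x\in\mathbb R^n,\ M_{s'}x\le b_{s'}\}$ be the scaled polytope. The condition is that for every action $a$, every $s'\ne s_\ast$ and every $\lambda\ge0$, the probability under $\mathbb P$ that $d_a+w$ lies on the boundary of $R_{s'}(\lambda)$ is zero. *)

theory Defs
  imports "HOL-Probability.Probability"
begin

section \<open>Dynamics and control input\<close>

definition successor ::
    "real^'n^'n \<Rightarrow> real^'p^'n \<Rightarrow> (nat \<Rightarrow> real^'n) \<Rightarrow> nat \<Rightarrow> real^'n \<Rightarrow> real^'p \<Rightarrow> real^'n \<Rightarrow> real^'n" where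
  "successor A B q k x u w = A *v x + B *v u + q k + w"

definition is_pseudoinverse :: "real^'p^'n \<Rightarrow> real^'n^'p \<Rightarrow> bool" where
  "is_pseudoinverse B X \<longleftrightarrow>
     B ** X ** B = B \<and> X ** B ** X = X \<and>
     transpose (B ** X) = B ** X \<and> transpose (X ** B) = X ** B"

definition control ::
    "real^'n^'n \<Rightarrow> real^'n^'p \<Rightarrow> (nat \<Rightarrow> real^'n) \<Rightarrow> ('a \<Rightarrow> real^'n) \<Rightarrow> nat \<Rightarrow> real^'n \<Rightarrow> 'a \<Rightarrow> real^'p" where
  "control A Bplus q d k x a = Bplus *v (d a - q k - A *v x)"


section \<open>Polytopic partition\<close>

text \<open>\<open>M j\<close> is the \<open>j\<close>-th row of the matrix and \<open>m\<close> the number of rows, which may differ from one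
  polytope to another.\<close>

definition hpoly :: "nat \<Rightarrow> (nat \<Rightarrow> real^'n) \<Rightarrow> (nat \<Rightarrow> real) \<Rightarrow> (real^'n) set" where
  "hpoly m M b = {x. \<forall>j<m. M j \<bullet> x \<le> b j}"

text \<open>The sets \<open>T i\<close> are the closed polytopes and the sets \<open>R i\<close> the pairwise disjoint regions
  obtained from them by allotting each shared boundary point to one of the polytopes containing
  it. As the regions cover all of \<open>\<Union>i. T i\<close>, a point lying in \<open>T i\<close> only is in \<open>R i\<close>.\<close>

definition polytopic_partition ::
    "(real^'n) set \<Rightarrow> nat \<Rightarrow> (nat \<Rightarrow> (real^'n) set) \<Rightarrow> (nat \<Rightarrow> (real^'n) set) \<Rightarrow> bool" where
  "polytopic_partition X v T R \<longleftrightarrow>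
     bounded X \<and>
     (\<forall>i\<in>{1..v}. bounded (T i) \<and> aff_dim (T i) = int (CARD('n)) \<and> R i \<subseteq> T i) \<and>
     (\<forall>i\<in>{1..v}. \<forall>j\<in>{1..v}. i \<noteq> j \<longrightarrow> T i \<inter> T j \<subseteq> frontier (T i) \<inter> frontier (T j)) \<and>
     disjoint_family_on R {1..v} \<and>
     X = (\<Union>i\<in>{1..v}. R i) \<and>
     X = (\<Union>i\<in>{1..v}. T i)"


section \<open>States, actions and transition probabilities\<close>

datatype state = Polytopic nat | Absorbing

definition states :: "nat \<Rightarrow> state set" where
  "states v = Polytopic ` {1..v} \<union> {Absorbing}"

definition region :: "(real^'n) set \<Rightarrow> (nat \<Rightarrow> (real^'n) set) \<Rightarrow> state \<Rightarrow> (real^'n) set" where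
  "region X R s = (case s of Polytopic i \<Rightarrow> R i | Absorbing \<Rightarrow> UNIV - X)"

definition enabled ::
    "real^'n^'n \<Rightarrow> real^'p^'n \<Rightarrow> (real^'p) set \<Rightarrow> (nat \<Rightarrow> real^'n) \<Rightarrow> 'a set \<Rightarrow> ('a \<Rightarrow> real^'n)
      \<Rightarrow> (state \<Rightarrow> (real^'n) set) \<Rightarrow> state \<Rightarrow> 'a set" where
  "enabled A B U q Act d Reg s =
     {a \<in> Act. \<forall>x\<in>Reg s. \<forall>k. \<exists>u\<in>U. d a = A *v x + B *v u + q k}"

text \<open>The value does not depend on \<open>s\<close>; see \<open>transition_prob_eq_successor\<close> below.\<close>

definition transition_prob ::
    "(real^'n) measure \<Rightarrow> ('a \<Rightarrow> real^'n) \<Rightarrow> (state \<Rightarrow> (real^'n) set) \<Rightarrow> state \<Rightarrow> 'a \<Rightarrow> state \<Rightarrow> real" where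
  "transition_prob P d Reg s a s' = measure P {w \<in> space P. d a + w \<in> Reg s'}"

lemma successor_control:
  fixes A :: "real^'n^'n" and B :: "real^'p^'n"
  assumes rank: "rank B = CARD('n)" and pinv: "is_pseudoinverse B Bplus"
  shows "successor A B q k x (control A Bplus q d k x a) w = d a + w"
proof -
  have "surj ((*v) B)"
    using rank full_rank_surjective by blast
  then obtain C where C: "B ** C = mat 1"
    using matrix_right_invertible_surjective by blast
  have "B ** Bplus ** B ** C = B ** C"
    using pinv by (simp add: is_pseudoinverse_def)
  then have "B ** Bplus = mat 1"
    by (simp add: C flip: matrix_mul_assoc)
  then show ?thesis
    by (simp add: successor_def control_def matrix_vector_mul_assoc)
qed

lemma transition_prob_eq_successor:
  fixes A :: "real^'n^'n" and B :: "real^'p^'n"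
  assumes "rank B = CARD('n)" and "is_pseudoinverse B Bplus" and "x \<in> Reg s"
  shows "transition_prob P d Reg s a s' =
    measure P {w \<in> space P. successor A B q k x (control A Bplus q d k x a) w \<in> Reg s'}"
  using assms by (simp add: transition_prob_def successor_control)


section \<open>Non-accumulation condition\<close>

definition chebyshev_center :: "(real^'n) set \<Rightarrow> real^'n \<Rightarrow> bool" where
  "chebyshev_center T c \<longleftrightarrow>
     (\<exists>r\<ge>0. cball c r \<subseteq> T \<and> (\<forall>c' r'. cball c' r' \<subseteq> T \<longrightarrow> r' \<le> r))"

definition scaled :: "real^'n \<Rightarrow> real \<Rightarrow> (real^'n) set \<Rightarrow> (real^'n) set" where
  "scaled h l T = {h + l *\<^sub>R (x - h) | x. x \<in> T}"

definition non_accumulation ::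
    "(real^'n) measure \<Rightarrow> 'a set \<Rightarrow> ('a \<Rightarrow> real^'n) \<Rightarrow> nat \<Rightarrow> (nat \<Rightarrow> (real^'n) set)
      \<Rightarrow> (nat \<Rightarrow> real^'n) \<Rightarrow> bool" where
  "non_accumulation P Act d v T h \<longleftrightarrow>
     (\<forall>a\<in>Act. \<forall>i\<in>{1..v}. \<forall>l\<ge>0.
        measure P {w \<in> space P. d a + w \<in> frontier (scaled (h i) l (T i))} = 0)"


section \<open>Sample count and probability bounds\<close>

definition N_out ::
    "nat \<Rightarrow> ('a \<Rightarrow> real^'n) \<Rightarrow> (state \<Rightarrow> (real^'n) set) \<Rightarrow> 'a \<Rightarrow> state \<Rightarrow> (nat \<Rightarrow> real^'n) \<Rightarrow> nat" where
  "N_out N d Reg a s' w = card {i \<in> {1..N}. d a + w i \<notin> Reg s'}"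

definition p_lower :: "nat \<Rightarrow> real \<Rightarrow> nat \<Rightarrow> real" where
  "p_lower N \<beta> K =
     (if K = N then 0
      else THE p. 0 \<le> p \<and> p \<le> 1 \<and>
        \<beta> / (2 * real N) = (\<Sum>i=0..K. real (N choose i) * (1 - p) ^ i * p ^ (N - i)))"

definition p_upper :: "nat \<Rightarrow> real \<Rightarrow> nat \<Rightarrow> real" where
  "p_upper N \<beta> K =
     (if K = 0 then 1
      else THE p. 0 \<le> p \<and> p \<le> 1 \<and>
        \<beta> / (2 * real N) = 1 - (\<Sum>i=0..K-1. real (N choose i) * (1 - p) ^ i * p ^ (N - i)))"

end

theory Submission
  imports Defs
begin

text \<open>
  The argument of Clopper and Pearson. If \<open>p\<close> is the probability of the region, then \<open>N_out\<close> is
  binomially distributed with parameters \<open>N\<close> and \<open>1 - p\<close>, and for fixed \<open>K < N\<close> the probability of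
  at most \<open>K\<close> samples outside increases strictly from 0 to 1 in \<open>p\<close>. Hence the lower bound can exceed
  \<open>p\<close> only if the lower tail at the observed count is at most \<open>\<beta> / (2 * N)\<close>; the counts with this
  property have total probability at most \<open>\<beta> / (2 * N)\<close>, since they all lie in the tail below the
  largest of them. Upper tails are treated alike, so the bounds fail with probability at most
  \<open>\<beta> / N \<le> \<beta>\<close>.
\<close>

section \<open>The binomial lower tail as a function of the probability of the region\<close>

definition binomial_cdf :: "nat \<Rightarrow> nat \<Rightarrow> real \<Rightarrow> real" where
  "binomial_cdf N K p = (\<Sum>i=0..K. real (N choose i) * (1 - p) ^ i * p ^ (N - i))"

text \<open>The sum of derivatives telescopes: differentiating the summand for \<open>Suc K\<close>
  gives a difference whose negative part cancels the derivative of the sum up to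
  \<open>K\<close>.\<close>

lemma has_real_derivative_binomial_cdf:
  assumes "K < N"
  shows "(binomial_cdf N K has_real_derivative
    real (N - K) * real (N choose K) * (1 - p) ^ K * p ^ (N - Suc K)) (at p)"
  using assms
proof (induction K)
  case 0
  have "((\<lambda>p. p ^ N) has_real_derivative real N * p ^ (N - Suc 0)) (at p)"
    by (auto intro!: derivative_eq_intros)
  then show ?case
    by (simp add: binomial_cdf_def[abs_def])
next
  case (Suc K)
  define c where "c = real (N choose Suc K)"
  \<comment> \<open>Absorption identity matching the coefficients of the two terms that
    cancel.\<close>
  have c: "real (N - K) * real (N choose K) = real (Suc K) * c"
    unfolding c_def by (metis binomial_absorb_comp binomial_absorption of_nat_mult)
  have *: "((\<lambda>p. c * (1 - p) ^ Suc K * p ^ (N - Suc K)) has_real_derivative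
      c * (1 - p) ^ Suc K * (real (N - Suc K) * p ^ (N - Suc (Suc K)))
      - c * (real (Suc K) * (1 - p) ^ K) * p ^ (N - Suc K)) (at p)"
    by (rule derivative_eq_intros refl)+ (simp add: algebra_simps)
  have "K < N"
    using Suc.prems by simp
  have "((\<lambda>p. binomial_cdf N K p + c * (1 - p) ^ Suc K * p ^ (N - Suc K)) has_real_derivative
      real (N - Suc K) * c * (1 - p) ^ Suc K * p ^ (N - Suc (Suc K))) (at p)"
    by (rule DERIV_cong[OF DERIV_add[OF Suc.IH[OF \<open>K < N\<close>] *]])
      (simp only: c, simp add: algebra_simps del: of_nat_Suc power_Suc)
  then show ?case
    by (simp add: binomial_cdf_def[abs_def] c_def)
qed

lemma continuous_on_binomial_cdf: "continuous_on S (binomial_cdf N K)"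
  unfolding binomial_cdf_def[abs_def] by (intro continuous_intros)

lemma binomial_cdf_less:
  assumes "K < N" "0 \<le> x" "x < y" "y \<le> 1"
  shows "binomial_cdf N K x < binomial_cdf N K y"
\<comment> \<open>The derivative may vanish at 0 and 1, so positivity is used on the open interval
  only, with continuity at the ends.\<close>
proof (rule DERIV_pos_imp_increasing_open[OF \<open>x < y\<close>])
  fix z assume "x < z" "z < y"
  with assms have "0 < real (N - K) * real (N choose K) * (1 - z) ^ K * z ^ (N - Suc K)"
    by (auto intro!: mult_pos_pos)
  with has_real_derivative_binomial_cdf[OF \<open>K < N\<close>, of z]
  show "\<exists>D. (binomial_cdf N K has_real_derivative D) (at z) \<and> D > 0"
    by blast
qed (rule continuous_on_binomial_cdf)

lemma binomial_cdf_0: "K < N \<Longrightarrow> binomial_cdf N K 0 = 0"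
  by (auto simp: binomial_cdf_def intro!: sum.neutral)

lemma binomial_cdf_1: "binomial_cdf N K 1 = 1"
  by (simp add: binomial_cdf_def sum.atLeast_Suc_atMost)

lemma binomial_cdf_full: "binomial_cdf N N p = 1"
  using binomial_ring[of "1 - p" p N] by (simp add: binomial_cdf_def atLeast0AtMost)

text \<open>Makes the definite descriptions in \<open>p_lower\<close> and \<open>p_upper\<close>
  meaningful: existence by the intermediate value theorem, uniqueness by strict
  monotonicity.\<close>

lemma binomial_cdf_ex1:
  assumes "K < N" "0 \<le> c" "c \<le> 1"
  shows "\<exists>!p. 0 \<le> p \<and> p \<le> 1 \<and> c = binomial_cdf N K p"
proof (rule ex_ex1I)
  have "\<exists>p\<ge>0. p \<le> 1 \<and> binomial_cdf N K p = c"
    using assms by (intro IVT' continuous_on_binomial_cdf) (auto simp: binomial_cdf_0 binomial_cdf_1)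
  then show "\<exists>p. 0 \<le> p \<and> p \<le> 1 \<and> c = binomial_cdf N K p"
    by auto
next
  show "x = y" if "0 \<le> x \<and> x \<le> 1 \<and> c = binomial_cdf N K x"
    "0 \<le> y \<and> y \<le> 1 \<and> c = binomial_cdf N K y" for x y
    using binomial_cdf_less[OF \<open>K < N\<close>, of x y] binomial_cdf_less[OF \<open>K < N\<close>, of y x] that
    by (cases x y rule: linorder_cases) auto
qed

section \<open>What a failing bound says about the tail at the observed count\<close>

lemma p_lower_greater_imp:
  assumes "K \<le> N" "0 < \<beta>" "\<beta> < 1" "0 \<le> p" "p \<le> 1" "p < p_lower N \<beta> K"
  shows "binomial_cdf N K p \<le> \<beta> / (2 * real N)"
proof -
  \<comment> \<open>At \<open>K = N\<close> the bound is 0 by convention and cannot exceed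
    \<open>p\<close>.\<close>
  have "K < N"
    using assms by (cases "K = N") (auto simp: p_lower_def)
  with assms have "\<beta> / (2 * real N) \<le> 1"
    by (simp add: divide_simps)
  then have "\<exists>!p. 0 \<le> p \<and> p \<le> 1 \<and> \<beta> / (2 * real N) = binomial_cdf N K p"
    using \<open>K < N\<close> assms by (intro binomial_cdf_ex1) auto
  from theI'[OF this] have "p_lower N \<beta> K \<le> 1" "\<beta> / (2 * real N) = binomial_cdf N K (p_lower N \<beta> K)"
    using \<open>K < N\<close> by (simp_all add: p_lower_def binomial_cdf_def)
  then show ?thesis
    using binomial_cdf_less[OF \<open>K < N\<close>, of p "p_lower N \<beta> K"] assms by simp
qed

text \<open>The upper tail starting at \<open>K\<close> is the complement of the lower tail at
  \<open>K - 1\<close>; the conclusion records \<open>K > 0\<close> because truncated subtraction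
  would falsify this at 0. There the bound is 1, so it cannot fail.\<close>

lemma p_upper_less_imp:
  assumes "K \<le> N" "0 < \<beta>" "\<beta> < 1" "0 \<le> p" "p \<le> 1" "p_upper N \<beta> K < p"
  shows "K > 0 \<and> 1 - binomial_cdf N (K - 1) p \<le> \<beta> / (2 * real N)"
proof -
  have "K > 0"
    using assms by (cases "K = 0") (auto simp: p_upper_def)
  then have K: "K - 1 < N"
    using assms by auto
  with assms have "\<beta> / (2 * real N) \<le> 1"
    by (simp add: divide_simps)
  then have "\<exists>!p. 0 \<le> p \<and> p \<le> 1 \<and> 1 - \<beta> / (2 * real N) = binomial_cdf N (K - 1) p"
    using K assms by (intro binomial_cdf_ex1) auto
  then have "\<exists>!p. 0 \<le> p \<and> p \<le> 1 \<and> \<beta> / (2 * real N) = 1 - binomial_cdf N (K - 1) p"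
    by (auto simp: algebra_simps)
  from theI'[OF this]
  have "0 \<le> p_upper N \<beta> K" "\<beta> / (2 * real N) = 1 - binomial_cdf N (K - 1) (p_upper N \<beta> K)"
    using \<open>K > 0\<close> by (simp_all add: p_upper_def binomial_cdf_def)
  then show ?thesis
    using binomial_cdf_less[OF K, of "p_upper N \<beta> K" p] assms \<open>K > 0\<close> by simp
qed

text \<open>\<open>S\<close> lies in \<open>{0..Max S}\<close> and \<open>Max S\<close> belongs to
  \<open>S\<close>, so a single tail bound covers all of \<open>S\<close> and the errors do not add
  up.\<close>

lemma sum_le_of_lower_tails:
  fixes f :: "nat \<Rightarrow> real"
  assumes "finite S" "\<And>k. 0 \<le> f k" "0 \<le> e" "\<And>k. k \<in> S \<Longrightarrow> sum f {0..k} \<le> e"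
  shows "sum f S \<le> e"
proof (cases "S = {}")
  case False
  have "sum f S \<le> sum f {0..Max S}"
    using assms by (intro sum_mono2) auto
  also have "\<dots> \<le> e"
    using False assms by simp
  finally show ?thesis .
qed (simp add: assms)

lemma sum_le_of_upper_tails:
  fixes f :: "nat \<Rightarrow> real"
  assumes "S \<subseteq> {..n}" "\<And>k. 0 \<le> f k" "0 \<le> e" "\<And>k. k \<in> S \<Longrightarrow> sum f {k..n} \<le> e"
  shows "sum f S \<le> e"
proof (cases "S = {}")
  case False
  have S: "finite S"
    using assms(1) finite_subset by blast
  have "sum f S \<le> sum f {Min S..n}"
    using assms S by (intro sum_mono2) auto
  also have "\<dots> \<le> e"
    using False S assms by simp
  finally show ?thesis .
qed (simp add: assms)

section \<open>Distribution of the number of samples outside an event\<close>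

lemma (in prob_space) PiM_count_pattern:
  assumes I: "finite I" and E: "E \<in> events" and S: "S \<subseteq> I"
  shows "{w \<in> space (Pi\<^sub>M I (\<lambda>_. M)). {i\<in>I. w i \<notin> E} = S} \<in> sets (Pi\<^sub>M I (\<lambda>_. M))" (is "?A \<in> _")
    and "measure (Pi\<^sub>M I (\<lambda>_. M)) {w \<in> space (Pi\<^sub>M I (\<lambda>_. M)). {i\<in>I. w i \<notin> E} = S}
      = (1 - prob E) ^ card S * prob E ^ (card I - card S)"
proof -
  have compl: "measure M (space M - E) = 1 - measure M E"
    using E by (rule prob_compl)
  interpret finite_product_prob_space "\<lambda>_. M" I
    by unfold_locales (rule I)
  let ?F = "\<lambda>i. if i \<in> S then space M - E else E"
  \<comment> \<open>Fixing exactly which samples miss \<open>E\<close> describes a box, so its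
    measure is a product.\<close>
  have eq: "?A = Pi\<^sub>E I ?F"
    using S sets.sets_into_space[OF E]
    by (auto simp: space_PiM PiE_def Pi_def extensional_def split: if_splits)
  show "?A \<in> sets (Pi\<^sub>M I (\<lambda>_. M))"
    unfolding eq using E I by (intro sets_PiM_I_finite) auto
  have "measure (Pi\<^sub>M I (\<lambda>_. M)) ?A = (\<Prod>i\<in>I. measure M (?F i))"
    unfolding eq using E by (intro finite_measure_PiM_emb) auto
  also have "\<dots> = (\<Prod>i\<in>I. if i \<in> S then 1 - measure M E else measure M E)"
    by (intro prod.cong) (auto simp: compl)
  also have "\<dots> = (1 - measure M E) ^ card S * measure M E ^ (card I - card S)"
    using I S by (subst prod.If_cases) (auto simp: Int_absorb1 card_Diff_subset finite_subset
        simp flip: Diff_eq)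
  finally show "measure (Pi\<^sub>M I (\<lambda>_. M)) ?A = (1 - measure M E) ^ card S * measure M E ^ (card I - card S)" .
qed

text \<open>The event is a finite disjoint union of patterns, hence measurable for any predicate
  \<open>Q\<close>; patterns of equal cardinality have equal probability, and counting them gives
  the binomial coefficient.\<close>

lemma (in prob_space) PiM_count_binomial:
  assumes I: "finite I" and E: "E \<in> events"
  shows "measure (Pi\<^sub>M I (\<lambda>_. M)) {w \<in> space (Pi\<^sub>M I (\<lambda>_. M)). Q (card {i\<in>I. w i \<notin> E})}
    = (\<Sum>k\<in>{k. k \<le> card I \<and> Q k}.
        real (card I choose k) * (1 - prob E) ^ k * prob E ^ (card I - k))"
proof -
  interpret PI: prob_space "Pi\<^sub>M I (\<lambda>_. M)"
    by (intro prob_space_PiM) unfold_locales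
  let ?A = "\<lambda>S. {w \<in> space (Pi\<^sub>M I (\<lambda>_. M)). {i\<in>I. w i \<notin> E} = S}"
  let ?g = "\<lambda>k. (1 - prob E) ^ k * prob E ^ (card I - k)"
  let ?\<S> = "{S. S \<subseteq> I \<and> Q (card S)}"
  have fin: "finite ?\<S>"
    using I by simp
  have "{w \<in> space (Pi\<^sub>M I (\<lambda>_. M)). Q (card {i\<in>I. w i \<notin> E})} = (\<Union>S\<in>?\<S>. ?A S)"
    by auto
  then have "measure (Pi\<^sub>M I (\<lambda>_. M)) {w \<in> space (Pi\<^sub>M I (\<lambda>_. M)). Q (card {i\<in>I. w i \<notin> E})}
      = (\<Sum>S\<in>?\<S>. measure (Pi\<^sub>M I (\<lambda>_. M)) (?A S))"
    using fin PiM_count_pattern(1)[OF I E]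
    by (auto intro!: PI.finite_measure_finite_Union simp: disjoint_family_on_def)
  also have "\<dots> = (\<Sum>S\<in>?\<S>. ?g (card S))"
    by (intro sum.cong) (auto simp: PiM_count_pattern(2)[OF I E])
  also have "\<dots> = (\<Sum>k\<in>{k. k \<le> card I \<and> Q k}. \<Sum>S\<in>{S\<in>?\<S>. card S = k}. ?g (card S))"
    using fin I by (intro sum.group[symmetric]) (auto intro: card_mono)
  also have "\<dots> = (\<Sum>k\<in>{k. k \<le> card I \<and> Q k}. real (card I choose k) * ?g k)"
  proof (intro sum.cong refl)
    fix k assume "k \<in> {k. k \<le> card I \<and> Q k}"
    then have "{S\<in>?\<S>. card S = k} = {S. S \<subseteq> I \<and> card S = k}"
      by auto
    then show "(\<Sum>S\<in>{S\<in>?\<S>. card S = k}. ?g (card S)) = real (card I choose k) * ?g k"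
      using n_subsets[OF I, of k] by simp
  qed
  finally show ?thesis
    by (simp add: mult.assoc)
qed

section \<open>Coverage of the interval\<close>

lemma clopper_pearson_coverage:
  assumes N: "N \<ge> 1" and \<beta>: "0 < \<beta>" "\<beta> < 1" and p: "0 \<le> p" "p \<le> 1"
  shows "(\<Sum>k\<in>{k. k \<le> N \<and> p_lower N \<beta> k \<le> p \<and> p \<le> p_upper N \<beta> k}.
      real (N choose k) * (1 - p) ^ k * p ^ (N - k)) \<ge> 1 - \<beta>"
proof -
  define f where "f k = real (N choose k) * (1 - p) ^ k * p ^ (N - k)" for k
  define G where "G = {k. k \<le> N \<and> p_lower N \<beta> k \<le> p \<and> p \<le> p_upper N \<beta> k}"
  define L where "L = {k. k \<le> N \<and> p < p_lower N \<beta> k}"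
  define H where "H = {k. k \<le> N \<and> p_upper N \<beta> k < p}"
  have fin: "finite G" "finite L" "finite H"
    by (simp_all add: G_def L_def H_def)
  have f0: "0 \<le> f k" for k
    using p by (simp add: f_def)
  have cdf: "binomial_cdf N K p = sum f {0..K}" for K
    by (simp add: binomial_cdf_def f_def)
  have total: "sum f {0..N} = 1"
    using binomial_cdf_full cdf by metis
  have e0: "0 \<le> \<beta> / (2 * real N)"
    using \<beta> by simp
  have L: "sum f L \<le> \<beta> / (2 * real N)"
    using p_lower_greater_imp[OF _ \<beta> p, of _ N] cdf
    by (intro sum_le_of_lower_tails[OF \<open>finite L\<close> f0 e0]) (auto simp: L_def)
  have H: "sum f H \<le> \<beta> / (2 * real N)"
  proof (rule sum_le_of_upper_tails[OF _ f0 e0])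
    fix k assume "k \<in> H"
    then have k: "k \<le> N" "k > 0" "1 - sum f {0..k - 1} \<le> \<beta> / (2 * real N)"
      using p_upper_less_imp[OF _ \<beta> p, of k N] cdf by (auto simp: H_def)
    have "sum f {0..k - 1} + sum f {k..N} = sum f {0..N}"
      using k by (subst sum.union_disjoint[symmetric]) (auto intro!: sum.cong)
    then show "sum f {k..N} \<le> \<beta> / (2 * real N)"
      using k total by simp
  qed (auto simp: H_def)
  have "1 = sum f (G \<union> (L \<union> H))"
    unfolding total[symmetric] by (intro sum.cong) (auto simp: G_def L_def H_def)
  \<comment> \<open>Subadditivity: the sums over the intersections are nonnegative and are
    dropped.\<close>
  also have "\<dots> \<le> sum f G + (sum f L + sum f H)"
    using sum.union_inter[of G "L \<union> H" f] sum.union_inter[of L H f]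
      sum_nonneg[of "G \<inter> (L \<union> H)" f] sum_nonneg[of "L \<inter> H" f] fin f0
    by simp
  also have "\<dots> \<le> sum f G + \<beta> / real N"
    using L H by (simp add: field_simps)
  also have "\<dots> \<le> sum f G + \<beta>"
    using N \<beta> by (simp add: divide_le_eq mult_le_cancel_left1)
  finally show ?thesis
    by (simp add: G_def f_def)
qed

theorem theorem1:
  fixes A :: "real^'n^'n" and B :: "real^'p^'n" and U :: "(real^'p) set"
    and q :: "nat \<Rightarrow> real^'n"
    and P :: "(real^'n) measure"
    and X :: "(real^'n) set" and v :: nat
    and m :: "nat \<Rightarrow> nat" and M :: "nat \<Rightarrow> nat \<Rightarrow> real^'n" and b :: "nat \<Rightarrow> nat \<Rightarrow> real"
    and R :: "nat \<Rightarrow> (real^'n) set" and h :: "nat \<Rightarrow> real^'n"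
    and Act :: "'a set" and d :: "'a \<Rightarrow> real^'n"
    and N :: nat and \<beta> :: real and s s' :: state and a :: 'a
  defines "T \<equiv> \<lambda>i. hpoly (m i) (M i) (b i)"
  defines "Reg \<equiv> region X R"
  assumes full_row_rank: "rank B = CARD('n)"
    and noise: "prob_space P" "(\<lambda>w. w) \<in> borel_measurable P"
    and partition: "polytopic_partition X v T R"
    and events: "\<And>a t. a \<in> Act \<Longrightarrow> t \<in> states v \<Longrightarrow> {w \<in> space P. d a + w \<in> Reg t} \<in> sets P"
    and actions: "finite Act"
    and centers: "\<And>i. i \<in> {1..v} \<Longrightarrow> chebyshev_center (T i) (h i)"
    and non_acc: "non_accumulation P Act d v T h"
    and N: "N \<ge> 1"
    and \<beta>: "0 < \<beta>" "\<beta> < 1"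
    and s: "s \<in> states v" and s': "s' \<in> states v"
    and a: "a \<in> enabled A B U q Act d Reg s"
  shows "measure (Pi\<^sub>M {1..N} (\<lambda>_. P))
           {w \<in> space (Pi\<^sub>M {1..N} (\<lambda>_. P)).
              p_lower N \<beta> (N_out N d Reg a s' w) \<le> transition_prob P d Reg s a s' \<and>
              transition_prob P d Reg s a s' \<le> p_upper N \<beta> (N_out N d Reg a s' w)}
         \<ge> 1 - \<beta>"
proof -
  interpret prob_space P
    by (rule noise)
  define E where "E = {w \<in> space P. d a + w \<in> Reg s'}"
  have E: "E \<in> sets P"
    using a s' events by (simp add: E_def enabled_def)
  have p: "transition_prob P d Reg s a s' = prob E"
    by (simp add: transition_prob_def E_def)
  \<comment> \<open>Points of the product space have all sampled coordinates in
    \<open>space P\<close>, so missing \<open>E\<close> means exactly missing the region.\<close>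
  have count: "N_out N d Reg a s' w = card {i\<in>{1..N}. w i \<notin> E}"
    if "w \<in> space (Pi\<^sub>M {1..N} (\<lambda>_. P))" for w
    using that by (auto simp: N_out_def E_def space_PiM intro!: arg_cong[where f = card])
  \<comment> \<open>The bounds depend on the samples only through the count, so coverage is a
    predicate of the count with \<open>prob E\<close> fixed.\<close>
  show ?thesis
    using PiM_count_binomial[OF finite_atLeastAtMost E, of 1 N
        "\<lambda>k. p_lower N \<beta> k \<le> prob E \<and> prob E \<le> p_upper N \<beta> k"]
      clopper_pearson_coverage[OF N \<beta>, of "prob E"]
    by (simp add: p count cong: conj_cong)
qed

end
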